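(* Let $0\le\epsilon<1$ and let $n\ge 1$ be a natural number. Let $d(n,\epsilon)$ be the smallest constant such that $$\sum_{k=1}^{n}\Big(\frac{1}{k}\sum_{j=1}^{k}a_j\Big)^2 k^\epsilon\le d(n,\epsilon)\,\sum_{k=1}^{n}a_k^2\,k^\epsilon$$ holds for all real numbers $a_1,\dots,a_n$. Then the equation $$\tan(\alpha\ln (n+1))+\frac{2\alpha}{1-\epsilon}=0$$ has exactly one solution $\alpha$ in the open interval $\left(\frac{\pi}{2\ln(n+1)},\frac{\pi}{\ln(n+1)}\right)$, and, with this $\alpha$, $$\frac{4}{(1-\epsilon)^2+4\alpha^2} \le d(n,\epsilon) \le \frac{4}{(1-\epsilon)^2}-\frac{4\sqrt2}{(1-\epsilon)^2\left(8+(1-\epsilon)^2 \right)}\cdot\frac{1}{\ln^2(n+1)}.$$ Moreover, with the same $\alpha$, let $$h_\epsilon(x)=x^{-(1+\epsilon)/2}\left(\frac{2\alpha}{1-\epsilon}\cos(\alpha\ln x)+\sin(\alpha\ln x) \right),\qquad 1\le x\le n+1,$$ and $$a_k=\int_k^{k+1}h_\epsilon(x)\,dx,\qquad k=1,\dots,n.$$ Then this particular sequence satisfies $$\sum_{k=1}^{n}\Big(\frac{1}{k}\sum_{j=1}^{k}a_j\Big)^2 k^\epsilon\ge \frac{4}{(1-\epsilon)^2+4\alpha^2}\,\sum_{k=1}^{n}a_k^2\,k^\epsilon.$$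
   Context: Here $\ln$ is the natural logarithm and $\ln^2 y=(\ln y)^2$. *)

theory Defs
  imports "HOL-Analysis.Analysis"
begin

definition hardy_lhs :: "nat \<Rightarrow> real \<Rightarrow> (nat \<Rightarrow> real) \<Rightarrow> real" where
  "hardy_lhs n \<epsilon> a = (\<Sum>k=1..n. (1 / real k * (\<Sum>j=1..k. a j))\<^sup>2 * real k powr \<epsilon>)"

definition hardy_rhs :: "nat \<Rightarrow> real \<Rightarrow> (nat \<Rightarrow> real) \<Rightarrow> real" where
  "hardy_rhs n \<epsilon> a = (\<Sum>k=1..n. (a k)\<^sup>2 * real k powr \<epsilon>)"

text \<open>
  Only the values \<open>a 1, \<dots>, a n\<close> enter the inequality, so quantifying over all sequences
  \<open>a\<close> is the same as quantifying over all real \<open>n\<close>-tuples. \<open>LEAST\<close> is unspecified unless a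
  least constant exists, so any nontrivial bound on \<open>hardy_const\<close> requires a proof that it does.
\<close>

definition hardy_const :: "nat \<Rightarrow> real \<Rightarrow> real" where
  "hardy_const n \<epsilon> = (LEAST d. \<forall>a. hardy_lhs n \<epsilon> a \<le> d * hardy_rhs n \<epsilon> a)"

definition h_fun :: "real \<Rightarrow> real \<Rightarrow> real \<Rightarrow> real" where
  "h_fun \<epsilon> \<alpha> x = x powr (- (1 + \<epsilon>) / 2)
     * (2 * \<alpha> / (1 - \<epsilon>) * cos (\<alpha> * ln x) + sin (\<alpha> * ln x))"

definition extremal_seq :: "real \<Rightarrow> real \<Rightarrow> nat \<Rightarrow> real" where
  "extremal_seq \<epsilon> \<alpha> k = integral {real k..real k + 1} (h_fun \<epsilon> \<alpha>)"

definition is_alpha :: "nat \<Rightarrow> real \<Rightarrow> real \<Rightarrow> bool" where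
  "is_alpha n \<epsilon> \<alpha> \<longleftrightarrow>
     \<alpha> \<in> {pi / (2 * ln (real n + 1)) <..< pi / ln (real n + 1)} \<and>
     tan (\<alpha> * ln (real n + 1)) + 2 * \<alpha> / (1 - \<epsilon>) = 0"

end

theory Submission
  imports Defs
begin

text \<open>
  Put \<open>s = (1 - \<epsilon>) / 2\<close>, so that \<open>s\<^sup>2 = (1 - \<epsilon>)\<^sup>2 / 4\<close> is the reciprocal of the classical constant.
  In terms of the partial sums \<open>A\<close>, Hardy's inequality compares the Dirichlet form
  \<open>\<Sum> k powr \<epsilon> (A k - A (k - 1))\<^sup>2\<close> with \<open>\<Sum> k powr (\<epsilon> - 2) (A k)\<^sup>2\<close>, where \<open>A 0 = 0\<close> and the
  right end is free. Its continuous model is the Euler equation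
  \<open>- (x powr \<epsilon> F')' = \<mu> x powr (\<epsilon> - 2) F\<close>, with the solution \<open>x powr s\<close> for \<open>\<mu> = s\<^sup>2\<close> and the
  oscillating solution \<open>x powr s * sin (\<alpha> * ln x)\<close> for \<open>\<mu> = s\<^sup>2 + \<alpha>\<^sup>2\<close>.

  Upper bound. The sequence \<open>k powr s\<close> is a positive supersolution of the discrete equation with
  \<open>\<mu> = s\<^sup>2\<close> (\<open>powr_supersolution\<close>). Writing \<open>A k = k powr s * B k\<close>, the Dirichlet form splits into at
  least \<open>s\<^sup>2\<close> times the Hardy sum and an energy of \<open>B\<close> (\<open>ground_state_representation\<close>). That energy
  lives on a path whose edge \<open>(k - 1, k)\<close> has conductance at least \<open>k - 1\<close>, so it dominates every
  \<open>(B k)\<^sup>2\<close> up to a factor of order \<open>ln n\<close> (\<open>weighted_poincare\<close>). The Hardy sum being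
  \<open>\<Sum> (B k)\<^sup>2 / k\<close>, the energy is at least a multiple of order \<open>1 / (ln n)\<^sup>2\<close> of it. The gain
  over \<open>s\<^sup>2\<close> exceeds the required one by a comfortable factor, so rough estimates suffice.

  Lower bound. The function \<open>h\<close> is the derivative of the oscillating solution \<open>F\<close> (up to a
  factor), and the equation for \<open>\<alpha>\<close> is the Neumann condition \<open>h (n + 1) = 0\<close>. Multiplying the Euler
  equation by \<open>F\<close> and integrating yields equality in the continuous problem with \<open>\<mu> = s\<^sup>2 + \<alpha>\<^sup>2\<close>.
  On \<open>[1, n + 1]\<close> the function \<open>F\<close> is nonnegative and increasing, so on each unit interval both sums
  differ from the integrals in the favourable direction (\<open>extremal_step\<close>).

  The two bounds concern all sequences and one particular sequence. They transfer to the best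
  constant because the set of admissible constants has a least element (\<open>hardy_const_valid\<close>,
  \<open>hardy_const_le\<close>).
\<close>

section \<open>The power function as a discrete supersolution\<close>

lemma one_plus_powr_neg_ge:
  fixes x p :: real
  assumes "-1 < x" "0 \<le> p"
  shows "1 - p * x \<le> (1 + x) powr (- p)"
proof -
  have "p * ln (1 + x) \<le> p * x"
    using assms ln_add_one_self_le_self2[of x] by (intro mult_left_mono) auto
  moreover have "1 + - p * ln (1 + x) \<le> exp (- p * ln (1 + x))"
    by (rule exp_ge_add_one_self)
  ultimately show ?thesis
    using assms by (simp add: powr_def)
qed

lemma nonneg_from_zero:
  fixes f f' :: "real \<Rightarrow> real"
  assumes "0 \<le> t" "f 0 = 0" "continuous_on {0..t} f"
    and "\<And>x. 0 < x \<Longrightarrow> x < t \<Longrightarrow> (f has_real_derivative f' x) (at x)"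
    and "\<And>x. 0 < x \<Longrightarrow> x < t \<Longrightarrow> 0 \<le> f' x"
  shows "0 \<le> f t"
proof (cases "t = 0")
  case False
  then have "f 0 \<le> f t"
    using assms by (intro DERIV_nonneg_imp_increasing_open[of 0 t f]) fastforce+
  with assms show ?thesis by simp
qed (use assms in auto)

text \<open>
  The difference of the two sides vanishes at \<open>t = 0\<close> together with its derivative, so it is
  enough that its second derivative is nonnegative. Bernoulli's inequality bounds that derivative
  below by \<open>s (1 - s) (1 - 2 s) t\<close>: the constant terms cancel exactly, which is the reason why
  \<open>s\<^sup>2\<close> is the largest factor that works for all small \<open>t\<close>.
\<close>

lemma powr_second_difference_ge:
  fixes s t :: real
  assumes s: "0 < s" "s \<le> 1/2" and t: "0 \<le> t" "t \<le> 1"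
  shows "s\<^sup>2 * t\<^sup>2 \<le> 1 - (1 - t) powr s - (1 + t) powr (1 - 2 * s) * ((1 + t) powr s - 1)"
proof -
  define f where "f x = 1 - (1 - x) powr s - (1 + x) powr (1 - s) + (1 + x) powr (1 - 2 * s)
    - s\<^sup>2 * x\<^sup>2" for x
  define f1 where "f1 x = s * (1 - x) powr (s - 1) - (1 - s) * (1 + x) powr (- s)
    + (1 - 2 * s) * (1 + x) powr (- 2 * s) - 2 * s\<^sup>2 * x" for x
  define f2 where "f2 x = s * (1 - s) * (1 - x) powr (s - 2) + s * (1 - s) * (1 + x) powr (- s - 1)
    - 2 * s * (1 - 2 * s) * (1 + x) powr (- 2 * s - 1) - 2 * s\<^sup>2" for x
  have df: "(f has_real_derivative f1 x) (at x)" if "0 < x" "x < 1" for x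
    unfolding f_def f1_def using that
    by (auto intro!: derivative_eq_intros simp: power2_eq_square algebra_simps)
  have df1: "(f1 has_real_derivative f2 x) (at x)" if "-1 < x" "x < 1" for x
    unfolding f1_def f2_def using that
    by (auto intro!: derivative_eq_intros simp: power2_eq_square algebra_simps)
  have f2: "0 \<le> f2 x" if "0 < x" "x < 1" for x
  proof -
    have "1 + (2 - s) * x \<le> (1 - x) powr (s - 2)"
      using one_plus_powr_neg_ge[of "-x" "2 - s"] that s by simp
    then have a: "s * (1 - s) * (1 + (2 - s) * x) \<le> s * (1 - s) * (1 - x) powr (s - 2)"
      using s by (intro mult_left_mono) auto
    have "- s - 1 = - (1 + s)" by simp
    then have "1 - (1 + s) * x \<le> (1 + x) powr (- s - 1)"
      by (rule ssubst, intro one_plus_powr_neg_ge) (use that s in auto)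
    then have b: "s * (1 - s) * (1 - (1 + s) * x) \<le> s * (1 - s) * (1 + x) powr (- s - 1)"
      using s by (intro mult_left_mono) auto
    have "(1 + x) powr (- 2 * s - 1) \<le> (1 + x) powr 0"
      using that s by (intro powr_mono) auto
    then have c: "2 * s * (1 - 2 * s) * (1 + x) powr (- 2 * s - 1) \<le> 2 * s * (1 - 2 * s) * 1"
      using that s by (intro mult_left_mono) auto
    have "0 \<le> s * (1 - s) * (1 - 2 * s) * x"
      using that s by simp
    also have "\<dots> = s * (1 - s) * (1 + (2 - s) * x) + s * (1 - s) * (1 - (1 + s) * x)
        - 2 * s * (1 - 2 * s) * 1 - 2 * s\<^sup>2"
      by (simp add: algebra_simps power2_eq_square)
    also have "\<dots> \<le> f2 x"
      unfolding f2_def using a b c by linarith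
    finally show ?thesis .
  qed
  have f1: "0 \<le> f1 x" if "0 < x" "x < 1" for x
  proof (rule nonneg_from_zero[where f = f1 and f' = f2])
    show "continuous_on {0..x} f1"
      by (rule DERIV_continuous_on[of _ _ f2], rule has_field_derivative_at_within, rule df1)
        (use that in auto)
  qed (use that f2 df1 in \<open>auto simp: f1_def\<close>)
  have "0 \<le> f t"
  proof (rule nonneg_from_zero[where f = f and f' = f1])
    show "continuous_on {0..t} f"
      unfolding f_def using s t
      by (intro continuous_on_add continuous_on_diff continuous_on_powr' continuous_intros) auto
  qed (use t f1 df in \<open>auto simp: f_def\<close>)
  moreover have "(1 + t) powr (1 - 2 * s) * (1 + t) powr s = (1 + t) powr (1 - s)"
    using t by (simp flip: powr_add)
  ultimately show ?thesis
    by (simp add: f_def algebra_simps)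
qed

text \<open>
  The function \<open>x powr s\<close> solves \<open>- (x powr (1 - 2 s) \<phi>')' = s\<^sup>2 x powr (- 1 - 2 s) \<phi>\<close>. On the
  integers the equation becomes an inequality, in the direction that a lower bound for the Hardy
  form requires. Homogeneity reduces it to the previous lemma with \<open>t = 1 / k\<close>.
\<close>

lemma powr_supersolution:
  fixes s :: real
  assumes s: "0 < s" "s \<le> 1/2" and k: "k \<ge> 1"
  shows "s\<^sup>2 * real k powr (- 1 - 2 * s) * real k powr s \<le>
    real k powr (1 - 2 * s) * (real k powr s - real (k - 1) powr s)
    - real (k + 1) powr (1 - 2 * s) * (real (k + 1) powr s - real k powr s)"
proof -
  define x where "x = real k"
  have x: "x \<ge> 1" using k by (simp add: x_def)
  define t where "t = 1 / x"
  have t: "0 \<le> t" "t \<le> 1" using x by (auto simp: t_def)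
  have m: "real (k - 1) = x * (1 - t)" "real (k + 1) = x * (1 + t)"
    using x k by (auto simp: t_def x_def field_simps of_nat_diff)
  have pm: "real (k - 1) powr s = x powr s * (1 - t) powr s"
    "real (k + 1) powr p = x powr p * (1 + t) powr p" for p
    unfolding m using x t by (auto intro!: powr_mult)
  have "x powr (1 - 2 * s) * x powr s * (s\<^sup>2 * t\<^sup>2) \<le> x powr (1 - 2 * s) * x powr s *
    (1 - (1 - t) powr s - (1 + t) powr (1 - 2 * s) * ((1 + t) powr s - 1))"
    by (intro mult_left_mono powr_second_difference_ge s t) auto
  moreover have "x powr (- 1 - 2 * s) = x powr (1 - 2 * s) * t\<^sup>2"
    using x powr_add[of x "1 - 2 * s" "-2"] powr_minus[of x 2]
    by (simp add: t_def divide_inverse power_inverse)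
  ultimately show ?thesis
    unfolding pm unfolding x_def[symmetric] by (simp add: algebra_simps)
qed

section \<open>Ground state representation and a weighted Poincare inequality\<close>

text \<open>
  Jacobi's substitution \<open>A = \<phi> B\<close> in a weighted Dirichlet form: the cross terms turn into squares
  of increments of the quotient \<open>B\<close>, and summation by parts puts the remaining terms on the
  diagonal. The right end is free, so a boundary term at \<open>n\<close> remains; it is nonnegative for
  positive weights and increasing \<open>\<phi>\<close>, and then it controls the level of \<open>B\<close>.
\<close>

lemma ground_state_representation:
  fixes \<phi> w B :: "nat \<Rightarrow> real"
  assumes "\<phi> 0 = 0"
  shows "(\<Sum>k=1..n. w k * (\<phi> k * B k - \<phi> (k - 1) * B (k - 1))\<^sup>2) =
    (\<Sum>k=1..n. (w k * (\<phi> k - \<phi> (k - 1)) - w (k + 1) * (\<phi> (k + 1) - \<phi> k)) * \<phi> k * (B k)\<^sup>2)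
    + w (n + 1) * (\<phi> (n + 1) - \<phi> n) * \<phi> n * (B n)\<^sup>2
    + (\<Sum>k=1..n. w k * \<phi> k * \<phi> (k - 1) * (B k - B (k - 1))\<^sup>2)"
proof (induction n)
  case 0
  show ?case using assms by simp
next
  case (Suc n)
  then show ?case
    by (simp add: power2_eq_square algebra_simps)
qed

text \<open>
  One step of Cauchy-Schwarz: the cross term \<open>2 x y\<close> is at most \<open>E / w + R w y\<^sup>2\<close> by the inequality
  of arithmetic and geometric means.
\<close>

lemma weighted_square_add_le:
  fixes x y R E w :: real
  assumes "x\<^sup>2 \<le> R * E" "0 \<le> R" "0 \<le> E" "0 < w"
  shows "(x + y)\<^sup>2 \<le> (R + 1 / w) * (E + w * y\<^sup>2)"
proof -
  have "(2 * x * y)\<^sup>2 = 4 * x\<^sup>2 * y\<^sup>2" by (simp add: power2_eq_square)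
  also have "\<dots> \<le> 4 * (R * E) * y\<^sup>2"
    using assms by (intro mult_right_mono) auto
  also have "\<dots> = (E / w + R * w * y\<^sup>2)\<^sup>2 - (E / w - R * w * y\<^sup>2)\<^sup>2"
    using assms by (simp add: power2_eq_square field_simps)
  also have "\<dots> \<le> (E / w + R * w * y\<^sup>2)\<^sup>2" by simp
  finally have "2 * x * y \<le> E / w + R * w * y\<^sup>2"
    by (rule power2_le_imp_le) (use assms in auto)
  with assms(1) have "x\<^sup>2 + 2 * x * y + y\<^sup>2 \<le> R * E + (E / w + R * w * y\<^sup>2) + y\<^sup>2"
    by linarith
  also have "\<dots> = (R + 1 / w) * (E + w * y\<^sup>2)"
    using assms by (simp add: field_simps)
  finally show ?thesis by (simp add: power2_sum algebra_simps)
qed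

text \<open>
  Walking from \<open>n\<close> down to \<open>k\<close>, the value \<open>B k\<close> is \<open>B n\<close> minus the increments in between. In
  electrical terms, the first factor is the resistance of the path from \<open>k\<close> to the ground behind
  \<open>n\<close>, where edge \<open>j\<close> has conductance \<open>w j\<close> and the last edge has conductance \<open>\<beta>\<close>; the second
  factor is the energy.
\<close>

lemma weighted_poincare:
  fixes B w :: "nat \<Rightarrow> real"
  assumes "k \<le> n" and \<beta>: "0 < \<beta>" and w: "\<And>j. k < j \<Longrightarrow> j \<le> n \<Longrightarrow> 0 < w j"
  shows "(B k)\<^sup>2 \<le> (1 / \<beta> + (\<Sum>j=k+1..n. 1 / w j)) *
    (\<beta> * (B n)\<^sup>2 + (\<Sum>j=k+1..n. w j * (B j - B (j - 1))\<^sup>2))"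
  using assms(1) w
proof (induction k rule: inc_induct)
  case base
  then show ?case using \<beta> by simp
next
  case (step k)
  have split: "(\<Sum>j=k+1..n. g j) = (\<Sum>j=Suc k+1..n. g j) + g (Suc k)" for g :: "nat \<Rightarrow> real"
    using step.hyps by (subst sum.atLeast_Suc_atMost) auto
  have "(B (Suc k) + (B k - B (Suc k)))\<^sup>2 \<le>
    ((1 / \<beta> + (\<Sum>j=Suc k+1..n. 1 / w j)) + 1 / w (Suc k)) *
    ((\<beta> * (B n)\<^sup>2 + (\<Sum>j=Suc k+1..n. w j * (B j - B (j - 1))\<^sup>2))
      + w (Suc k) * (B k - B (Suc k))\<^sup>2)"
    using step \<beta> by (intro weighted_square_add_le add_nonneg_nonneg sum_nonneg)
      (auto intro!: mult_nonneg_nonneg intro: less_imp_le)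
  then show ?case
    unfolding split by (simp add: power2_commute add.assoc)
qed

section \<open>Hardy inequality with a logarithmic remainder\<close>

text \<open>
  The factor must be at least \<open>1 / ln 2 = 1.4427...\<close> because of \<open>n = 1\<close>. With \<open>3/2\<close> the
  induction step reduces to \<open>1 / (n + 1) \<le> (3/2) / (n + 2)\<close>, which is valid from \<open>n = 1\<close> on.
\<close>

lemma harmonic_sum_le_ln:
  assumes "n \<ge> 1"
  shows "(\<Sum>k=1..n. 1 / real k) \<le> 3 / 2 * ln (real n + 1)"
  using assms
proof (induction n rule: dec_induct)
  case base
  have "2 / 3 \<le> ln (2::real)" using ln2_ge_two_thirds by simp
  then show ?case by simp
next
  case (step n)
  have "ln (real (n + 1) / real (n + 2)) \<le> real (n + 1) / real (n + 2) - 1"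
    by (intro ln_le_minus_one) simp
  then have "1 / real (n + 2) \<le> ln (real n + 2) - ln (real n + 1)"
    by (simp add: ln_div field_simps add_ac)
  moreover have "1 / real (n + 1) \<le> 3 / 2 * (1 / real (n + 2))"
    using step.hyps by (simp add: field_simps)
  ultimately have "1 / real (n + 1) \<le> 3 / 2 * (ln (real n + 2) - ln (real n + 1))"
    by (meson order_trans mult_left_mono zero_le_divide_iff zero_le_numeral)
  moreover have "real (Suc n) + 1 = real n + 2" by simp
  ultimately show ?case
    using step.IH by (simp add: add.commute)
qed

text \<open>
  The tangent of the concave function \<open>x powr s\<close> at \<open>x + 1\<close> lies above its graph; written
  multiplicatively, this is Young's inequality for \<open>x\<close> and \<open>x + 1\<close>.
\<close>

lemma powr_increment_ge:
  fixes s :: real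
  assumes s: "0 \<le> s" "s \<le> 1" and x: "0 < x"
  shows "s * (x + 1) powr (s - 1) \<le> (x + 1) powr s - x powr s"
proof -
  have "x powr s * (x + 1) powr (1 - s) \<le> s * x + (1 - s) * (x + 1)"
    using s x by (intro Youngs_inequality_0) auto
  then have "x powr s * (x + 1) powr (1 - s) * (x + 1) powr (s - 1) \<le>
      (x + 1 - s) * (x + 1) powr (s - 1)"
    by (intro mult_right_mono) (auto simp: algebra_simps)
  moreover have "(x + 1) powr (1 - s) * (x + 1) powr (s - 1) = 1"
    using x by (simp flip: powr_add)
  moreover have "(x + 1) * (x + 1) powr (s - 1) = (x + 1) powr s"
    using x powr_add[of "x + 1" 1 "s - 1"] by simp
  ultimately show ?thesis
    by (simp add: left_diff_distrib mult.assoc)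
qed

text \<open>
  The boundary weight is at least \<open>s (n / (n + 1)) powr s\<close>, and the worst case is \<open>n = 1\<close>,
  \<open>s = 1/2\<close>; this is where \<open>sqrt 2\<close> enters.
\<close>

lemma boundary_weight_ge:
  fixes s :: real
  assumes s: "0 < s" "s \<le> 1/2" and n: "n \<ge> 1"
  shows "s / sqrt 2 \<le>
    real (n + 1) powr (1 - 2 * s) * (real (n + 1) powr s - real n powr s) * real n powr s"
proof -
  define x where "x = real n"
  have x: "x \<ge> 1" using n by (simp add: x_def)
  have n1: "real (n + 1) = x + 1" by (simp add: x_def)
  have "1 / sqrt 2 = (1 / 2 :: real) powr (1 / 2)"
    by (simp add: powr_half_sqrt real_sqrt_divide)
  also have "\<dots> \<le> (1 / 2) powr s"
    using s by (intro powr_mono') auto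
  also have "\<dots> \<le> (x / (x + 1)) powr s"
    using s x by (intro powr_mono2) (auto simp: field_simps)
  finally have "s * (1 / sqrt 2) \<le> s * (x / (x + 1)) powr s"
    using s by (intro mult_left_mono) auto
  also have "\<dots> = (x + 1) powr (1 - 2 * s) * (s * (x + 1) powr (s - 1)) * x powr s"
  proof -
    have "(x + 1) powr (1 - 2 * s) * (x + 1) powr (s - 1) = (x + 1) powr (- s)"
      by (simp flip: powr_add)
    then have "(x + 1) powr (1 - 2 * s) * (s * (x + 1) powr (s - 1)) * x powr s
        = s * ((x + 1) powr (- s) * x powr s)"
      by (metis mult.assoc mult.left_commute)
    then show ?thesis using x by (simp add: powr_divide powr_minus_divide)
  qed
  also have "\<dots> \<le> (x + 1) powr (1 - 2 * s) * ((x + 1) powr s - x powr s) * x powr s"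
    using s x by (intro mult_right_mono mult_left_mono powr_increment_ge) auto
  finally show ?thesis by (simp add: n1 x_def add.commute)
qed

lemma edge_weight_ge:
  fixes s :: real
  assumes s: "0 < s" "s \<le> 1/2" and k: "k \<ge> 2"
  shows "real (k - 1) \<le> real k powr (1 - 2 * s) * real k powr s * real (k - 1) powr s"
proof -
  have "real (k - 1) = real (k - 1) powr (1 - s) * real (k - 1) powr s"
    using k by (simp flip: powr_add)
  also have "\<dots> \<le> real k powr (1 - s) * real (k - 1) powr s"
    using s by (intro mult_right_mono powr_mono2) auto
  also have "\<dots> = real k powr (1 - 2 * s) * real k powr s * real (k - 1) powr s"
    using k by (simp flip: powr_add)
  finally show ?thesis .
qed

text \<open>
  With \<open>\<phi> k = k powr s\<close> and partial sums \<open>A = \<phi> B\<close>, the left-hand side of Hardy's inequality is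
  \<open>\<Sum> (B k)\<^sup>2 / k\<close>. The diagonal part of the ground state representation yields the sharp term
  with factor \<open>s\<^sup>2\<close>. The rest is an energy \<open>E\<close> of \<open>B\<close>, with edge weights at least \<open>k - 1\<close> and
  boundary weight at least \<open>s / sqrt 2\<close>. All resistances to the boundary are therefore at most
  \<open>sqrt 2 / s + H\<close>, and summing the Poincare inequality against \<open>1 / k\<close> costs another
  factor \<open>H\<close>.
\<close>

lemma hardy_rhs_ge_hardy_lhs_plus_remainder:
  fixes s :: real and a :: "nat \<Rightarrow> real"
  assumes s: "0 < s" "s \<le> 1/2" and n: "n \<ge> 1"
  defines "H \<equiv> \<Sum>k=1..n. 1 / real k"
  shows "s\<^sup>2 * hardy_lhs n (1 - 2 * s) a + hardy_lhs n (1 - 2 * s) a / (H * (sqrt 2 / s + H))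
    \<le> hardy_rhs n (1 - 2 * s) a"
proof -
  define A where "A k = (\<Sum>j=1..k. a j)" for k
  define \<phi> where "\<phi> k = real k powr s" for k
  define B where "B k = A k / \<phi> k" for k
  define w where "w k = real k powr (1 - 2 * s)" for k
  define v where "v k = w k * \<phi> k * \<phi> (k - 1)" for k
  define \<beta> where "\<beta> = w (n + 1) * (\<phi> (n + 1) - \<phi> n) * \<phi> n"
  define E where "E = \<beta> * (B n)\<^sup>2 + (\<Sum>k=2..n. v k * (B k - B (k - 1))\<^sup>2)"
  have \<phi>0: "\<phi> 0 = 0" by (simp add: \<phi>_def)
  have \<phi>_pos: "\<phi> k > 0" if "k \<ge> 1" for k using that by (simp add: \<phi>_def)
  have A_eq: "\<phi> k * B k = A k" for k
    using \<phi>_pos[of k] by (cases "k = 0") (auto simp: B_def A_def \<phi>0)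
  have \<beta>_ge: "s / sqrt 2 \<le> \<beta>"
    unfolding \<beta>_def w_def \<phi>_def by (rule boundary_weight_ge) fact+
  then have \<beta>: "\<beta> > 0" using s by (smt (verit) divide_pos_pos real_sqrt_gt_zero)
  have v_ge: "real (k - 1) \<le> v k" if "k \<ge> 2" for k
    unfolding v_def w_def \<phi>_def by (rule edge_weight_ge) (use s that in auto)
  have v_pos: "0 < v k" if "k \<ge> 2" for k
    by (rule less_le_trans[OF _ v_ge[OF that]]) (use that in simp)
  have H: "H \<ge> 1"
    unfolding H_def using n by (subst sum.atLeast_Suc_atMost) (auto intro: sum_nonneg)
  have lhs: "hardy_lhs n (1 - 2 * s) a = (\<Sum>k=1..n. (B k)\<^sup>2 / real k)"
    unfolding hardy_lhs_def
  proof (intro sum.cong refl)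
    fix k assume "k \<in> {1..n}"
    then have k: "real k > 0" by simp
    have e: "1 / real k ^ 2 * real k powr (1 - 2 * s) * (real k powr s)\<^sup>2 = 1 / real k"
    proof -
      have "real k powr (1 - 2 * s) * (real k powr s)\<^sup>2 = real k"
        using k by (simp add: power2_eq_square flip: powr_add)
      then show ?thesis using k by (simp add: power2_eq_square)
    qed
    have "(1 / real k * (\<phi> k * B k))\<^sup>2 * real k powr (1 - 2 * s) =
        (1 / real k ^ 2 * real k powr (1 - 2 * s) * (real k powr s)\<^sup>2) * (B k)\<^sup>2"
      by (simp add: \<phi>_def power_mult_distrib power_divide mult_ac)
    then show "(1 / real k * (\<Sum>j=1..k. a j))\<^sup>2 * real k powr (1 - 2 * s) = (B k)\<^sup>2 / real k"
      unfolding e A_eq A_def by simp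
  qed
  have "\<phi> k * B k - \<phi> (k - 1) * B (k - 1) = a k" if "k \<ge> 1" for k
    unfolding A_eq using that by (cases k) (auto simp: A_def)
  then have "hardy_rhs n (1 - 2 * s) a =
      (\<Sum>k=1..n. w k * (\<phi> k * B k - \<phi> (k - 1) * B (k - 1))\<^sup>2)"
    unfolding hardy_rhs_def w_def by (intro sum.cong) (auto simp: mult.commute)
  also have "\<dots> = (\<Sum>k=1..n. (w k * (\<phi> k - \<phi> (k - 1)) - w (k + 1) * (\<phi> (k + 1) - \<phi> k)) * \<phi> k * (B k)\<^sup>2)
      + \<beta> * (B n)\<^sup>2 + (\<Sum>k=1..n. v k * (B k - B (k - 1))\<^sup>2)"
    unfolding \<beta>_def v_def by (intro ground_state_representation \<phi>0)
  also have "(\<Sum>k=1..n. v k * (B k - B (k - 1))\<^sup>2) = (\<Sum>k=2..n. v k * (B k - B (k - 1))\<^sup>2)"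
    using n by (subst sum.atLeast_Suc_atMost) (auto simp: v_def \<phi>0 numeral_2_eq_2)
  finally have rhs: "hardy_rhs n (1 - 2 * s) a =
      (\<Sum>k=1..n. (w k * (\<phi> k - \<phi> (k - 1)) - w (k + 1) * (\<phi> (k + 1) - \<phi> k)) * \<phi> k * (B k)\<^sup>2) + E"
    by (simp add: E_def)
  have "s\<^sup>2 * hardy_lhs n (1 - 2 * s) a \<le>
      (\<Sum>k=1..n. (w k * (\<phi> k - \<phi> (k - 1)) - w (k + 1) * (\<phi> (k + 1) - \<phi> k)) * \<phi> k * (B k)\<^sup>2)"
    unfolding lhs sum_distrib_left
  proof (intro sum_mono)
    fix k assume "k \<in> {1..n}"
    then have k: "k \<ge> 1" by simp
    have "real k powr (- 1 - 2 * s) * \<phi> k * \<phi> k = 1 / real k"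
      using k by (simp add: \<phi>_def powr_minus_divide flip: powr_add)
    then have "s\<^sup>2 * ((B k)\<^sup>2 / real k) = s\<^sup>2 * real k powr (- 1 - 2 * s) * \<phi> k * \<phi> k * (B k)\<^sup>2"
      by (simp add: mult.assoc)
    also have "\<dots> \<le> (w k * (\<phi> k - \<phi> (k - 1)) - w (k + 1) * (\<phi> (k + 1) - \<phi> k)) * \<phi> k * (B k)\<^sup>2"
      unfolding w_def \<phi>_def by (intro mult_right_mono powr_supersolution s k) auto
    finally show "s\<^sup>2 * ((B k)\<^sup>2 / real k) \<le>
      (w k * (\<phi> k - \<phi> (k - 1)) - w (k + 1) * (\<phi> (k + 1) - \<phi> k)) * \<phi> k * (B k)\<^sup>2" .
  qed
  moreover have "hardy_lhs n (1 - 2 * s) a \<le> H * (sqrt 2 / s + H) * E"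
  proof -
    have "(B k)\<^sup>2 \<le> (sqrt 2 / s + H) * E" if "k \<in> {1..n}" for k
    proof -
      have "(B k)\<^sup>2 \<le> (1 / \<beta> + (\<Sum>j=k+1..n. 1 / v j)) *
          (\<beta> * (B n)\<^sup>2 + (\<Sum>j=k+1..n. v j * (B j - B (j - 1))\<^sup>2))"
        using that \<beta> v_pos by (intro weighted_poincare) auto
      also have "\<dots> \<le> (sqrt 2 / s + H) * E"
      proof (intro mult_mono)
        show "1 / \<beta> + (\<Sum>j=k+1..n. 1 / v j) \<le> sqrt 2 / s + H"
        proof (rule add_mono)
          show "1 / \<beta> \<le> sqrt 2 / s"
            using le_imp_inverse_le[OF \<beta>_ge] s by (simp add: inverse_eq_divide)
          have "(\<Sum>j=k+1..n. 1 / v j) \<le> (\<Sum>j=k+1..n. 1 / real (j - 1))"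
            using v_ge that by (intro sum_mono divide_left_mono) (auto intro!: mult_pos_pos v_pos)
          also have "\<dots> = (\<Sum>j=k..n-1. 1 / real j)"
            using n by (intro sum.reindex_bij_witness[of _ Suc "\<lambda>j. j - 1"]) auto
          also have "\<dots> \<le> H"
            unfolding H_def using that by (intro sum_mono2) auto
          finally show "(\<Sum>j=k+1..n. 1 / v j) \<le> H" .
        qed
        show "\<beta> * (B n)\<^sup>2 + (\<Sum>j=k+1..n. v j * (B j - B (j - 1))\<^sup>2) \<le> E"
          unfolding E_def using that v_pos
          by (intro add_left_mono sum_mono2) (auto intro!: mult_nonneg_nonneg intro: less_imp_le)
        show "0 \<le> sqrt 2 / s + H" using s H by simp
        show "0 \<le> \<beta> * (B n)\<^sup>2 + (\<Sum>j=k+1..n. v j * (B j - B (j - 1))\<^sup>2)"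
          using \<beta> v_pos that
          by (intro add_nonneg_nonneg sum_nonneg) (auto intro!: mult_nonneg_nonneg intro: less_imp_le)
      qed
      finally show ?thesis .
    qed
    then have "(\<Sum>k=1..n. (B k)\<^sup>2 / real k) \<le> (\<Sum>k=1..n. (sqrt 2 / s + H) * E / real k)"
      by (intro sum_mono divide_right_mono) auto
    also have "\<dots> = H * (sqrt 2 / s + H) * E"
      by (simp add: H_def sum_distrib_left sum_distrib_right mult_ac)
    finally show ?thesis unfolding lhs .
  qed
  then have "hardy_lhs n (1 - 2 * s) a / (H * (sqrt 2 / s + H)) \<le> E"
    using H s by (simp add: divide_le_eq mult_ac add_pos_pos)
  ultimately show ?thesis using rhs by linarith
qed

lemma hardy_lhs_nonneg: "0 \<le> hardy_lhs n \<epsilon> a"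
  by (simp add: hardy_lhs_def sum_nonneg)

lemma hardy_rhs_nonneg: "0 \<le> hardy_rhs n \<epsilon> a"
  by (simp add: hardy_rhs_def sum_nonneg)

text \<open>
  Only arithmetic is left: by \<open>hardy_rhs_ge_hardy_lhs_plus_remainder\<close> the constant \<open>D\<close> is admissible as soon as
  \<open>1 \<le> D (s\<^sup>2 + 1 / R)\<close>. Since \<open>R\<close> is quadratic in the harmonic sum, the gain \<open>1 / R\<close> is of order
  \<open>1 / L\<^sup>2\<close>.
\<close>

lemma hardy_inequality_log_remainder:
  fixes s :: real and n :: nat
  assumes s: "0 < s" "s \<le> 1/2" and n: "n \<ge> 1"
  shows "hardy_lhs n (1 - 2 * s) a \<le>
    (1 / s\<^sup>2 - sqrt 2 / (s\<^sup>2 * (8 + 4 * s\<^sup>2) * (ln (real n + 1))\<^sup>2)) * hardy_rhs n (1 - 2 * s) a"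
proof -
  define L where "L = ln (real n + 1)"
  define H where "H = (\<Sum>k=1..n. 1 / real k)"
  define R where "R = H * (sqrt 2 / s + H)"
  define q where "q = sqrt 2 / ((8 + 4 * s\<^sup>2) * L\<^sup>2)"
  define D where "D = (1 - q) / s\<^sup>2"
  have H: "1 \<le> H"
    unfolding H_def using n by (subst sum.atLeast_Suc_atMost) (auto intro: sum_nonneg)
  have HL: "H \<le> 3 / 2 * L"
    unfolding H_def L_def by (rule harmonic_sum_le_ln[OF n])
  with H have L: "1 \<le> 3 / 2 * L" by simp
  have R: "R > 0" using H s by (auto simp: R_def intro!: mult_pos_pos add_pos_pos)
  have "sqrt 2 \<le> sqrt ((3/2)\<^sup>2 :: real)" by (intro real_sqrt_le_mono) (simp add: power2_eq_square)
  then have sqrt2: "sqrt 2 \<le> (3/2 :: real)" by simp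
  have "sqrt 2 * (s\<^sup>2 * R + 1) \<le> (8 + 4 * s\<^sup>2) * L\<^sup>2"
  proof -
    \<comment> \<open>Both \<open>1\<close> and \<open>H\<close> are at most \<open>u\<close>, so the left side is bounded by a multiple of \<open>u\<^sup>2\<close>.\<close>
    define u where "u = 3 / 2 * L"
    have sH: "s * H \<le> u / 2"
      using mult_mono[of s "1/2" H u] s H HL by (simp add: u_def)
    have u: "1 \<le> u\<^sup>2" "u \<le> u\<^sup>2"
      using L power_increasing[of 1 2 u] by (auto simp: u_def one_le_power)
    have "(s * H)\<^sup>2 \<le> (u / 2)\<^sup>2"
      using sH s H by (intro power_mono) auto
    then have sH2: "(s * H)\<^sup>2 \<le> u\<^sup>2 / 4" by (simp add: power_divide)
    have "sqrt 2 * (s\<^sup>2 * R + 1) = 2 * (s * H) + sqrt 2 * ((s * H)\<^sup>2 + 1)"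
      using s by (simp add: R_def power2_eq_square algebra_simps)
    also have "\<dots> \<le> u + (3 / 2) * (u\<^sup>2 / 4 + u\<^sup>2)"
      using sH sH2 u sqrt2 by (intro add_mono mult_mono) auto
    also have "\<dots> \<le> 23 / 8 * u\<^sup>2" using u by simp
    also have "\<dots> \<le> 8 * L\<^sup>2" by (simp add: u_def power2_eq_square)
    also have "\<dots> \<le> (8 + 4 * s\<^sup>2) * L\<^sup>2" by (intro mult_right_mono) auto
    finally show ?thesis .
  qed
  moreover have "(8 + 4 * s\<^sup>2) * L\<^sup>2 > 0"
    using L by (intro mult_pos_pos add_pos_nonneg) auto
  ultimately have q: "q * (s\<^sup>2 * R + 1) \<le> 1"
    by (simp add: q_def divide_le_eq)
  have q0: "0 \<le> q" unfolding q_def by simp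
  have "q * 1 \<le> q * (s\<^sup>2 * R + 1)"
    using q0 R by (intro mult_left_mono) auto
  then have D0: "0 \<le> D" using q by (simp add: D_def)
  have "1 \<le> D * (s\<^sup>2 + 1 / R)"
    using q R s by (simp add: D_def field_simps)
  then have "hardy_lhs n (1 - 2 * s) a * 1 \<le> hardy_lhs n (1 - 2 * s) a * (D * (s\<^sup>2 + 1 / R))"
    by (intro mult_left_mono hardy_lhs_nonneg)
  also have "\<dots> = D * (s\<^sup>2 * hardy_lhs n (1 - 2 * s) a + hardy_lhs n (1 - 2 * s) a / R)"
    by (simp add: algebra_simps)
  also have "\<dots> \<le> D * hardy_rhs n (1 - 2 * s) a"
    unfolding R_def H_def
    by (intro mult_left_mono hardy_rhs_ge_hardy_lhs_plus_remainder s n D0)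
  also have "D = 1 / s\<^sup>2 - sqrt 2 / (s\<^sup>2 * (8 + 4 * s\<^sup>2) * L\<^sup>2)"
    by (simp add: D_def q_def diff_divide_distrib mult.assoc mult.commute)
  finally show ?thesis by (simp add: L_def)
qed

section \<open>The best constant is attained\<close>

text \<open>
  The admissible constants form a closed set: it is cut out by one weak inequality for each
  sequence. It is bounded below by \<open>0\<close>, as the constant sequence \<open>1\<close> shows, so as soon as it is
  nonempty its infimum is its least element.
\<close>

lemma
  assumes n: "n \<ge> 1" and d0: "\<And>a. hardy_lhs n \<epsilon> a \<le> d\<^sub>0 * hardy_rhs n \<epsilon> a"
  shows hardy_const_valid: "hardy_lhs n \<epsilon> a \<le> hardy_const n \<epsilon> * hardy_rhs n \<epsilon> a"
    and hardy_const_le: "(\<And>a. hardy_lhs n \<epsilon> a \<le> d * hardy_rhs n \<epsilon> a) \<Longrightarrow> hardy_const n \<epsilon> \<le> d"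
proof -
  define S where "S = {d. \<forall>a. hardy_lhs n \<epsilon> a \<le> d * hardy_rhs n \<epsilon> a}"
  have "0 \<le> d" if "d \<in> S" for d
  proof -
    have "0 < hardy_rhs n \<epsilon> (\<lambda>_. 1)"
      unfolding hardy_rhs_def using n by (intro sum_pos) auto
    moreover have "0 \<le> d * hardy_rhs n \<epsilon> (\<lambda>_. 1)"
      using that hardy_lhs_nonneg[of n \<epsilon> "\<lambda>_. 1"] unfolding S_def by (blast intro: order_trans)
    ultimately show ?thesis by (simp add: zero_le_mult_iff)
  qed
  then have bdd: "bdd_below S" by (auto simp: bdd_below_def)
  have ne: "S \<noteq> {}" using d0 by (auto simp: S_def)
  have "hardy_lhs n \<epsilon> a \<le> Inf S * hardy_rhs n \<epsilon> a" for a
  proof (cases "hardy_rhs n \<epsilon> a = 0")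
    case True
    then show ?thesis using d0[of a] by simp
  next
    case False
    then have pos: "0 < hardy_rhs n \<epsilon> a" using hardy_rhs_nonneg[of n \<epsilon> a] by simp
    have "hardy_lhs n \<epsilon> a / hardy_rhs n \<epsilon> a \<le> Inf S"
      using ne pos by (intro cInf_greatest) (auto simp: S_def divide_le_eq)
    then show ?thesis using pos by (simp add: divide_le_eq)
  qed
  note Inf_valid = this
  have Inf_le: "Inf S \<le> d" if "\<And>a. hardy_lhs n \<epsilon> a \<le> d * hardy_rhs n \<epsilon> a" for d
    using that by (intro cInf_lower bdd) (auto simp: S_def)
  have "hardy_const n \<epsilon> = Inf S"
    unfolding hardy_const_def by (intro Least_equality) (auto intro: Inf_valid Inf_le)
  then show "hardy_lhs n \<epsilon> a \<le> hardy_const n \<epsilon> * hardy_rhs n \<epsilon> a"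
    and "(\<And>a. hardy_lhs n \<epsilon> a \<le> d * hardy_rhs n \<epsilon> a) \<Longrightarrow> hardy_const n \<epsilon> \<le> d"
    using Inf_valid Inf_le by auto
qed

section \<open>The phase equation\<close>

text \<open>
  Multiplied by \<open>cos \<theta>\<close>, the equation has a continuous left side that is \<open>1\<close> at \<open>pi/2\<close> and negative
  at \<open>pi\<close>. Uniqueness is monotonicity of the tangent, moved by \<open>pi\<close> into its principal branch.
\<close>

lemma ex1_tan_plus_linear_eq_0:
  fixes c :: real
  assumes c: "c > 0"
  shows "\<exists>!\<theta>. \<theta> \<in> {pi/2<..<pi} \<and> tan \<theta> + c * \<theta> = 0"
proof -
  have "\<exists>\<theta>\<ge>pi/2. \<theta> \<le> pi \<and> sin \<theta> + c * \<theta> * cos \<theta> = 0"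
    by (rule IVT2') (use c in \<open>auto intro!: continuous_intros\<close>)
  then obtain \<theta> where \<theta>: "pi/2 \<le> \<theta>" "\<theta> \<le> pi" "sin \<theta> + c * \<theta> * cos \<theta> = 0" by blast
  have "\<theta> \<noteq> pi/2" using \<theta>(3) by (metis add.right_neutral cos_pi_half mult_zero_right sin_pi_half zero_neq_one)
  moreover have "\<theta> \<noteq> pi" using \<theta>(3) c by auto
  ultimately have \<theta>_in: "\<theta> \<in> {pi/2<..<pi}" using \<theta> by simp
  then have "cos \<theta> < 0" using cos_gt_zero_pi[of "pi - \<theta>"] by simp
  with \<theta> have "tan \<theta> + c * \<theta> = 0" by (simp add: tan_def field_simps)
  moreover have "x = y" if x: "x \<in> {pi/2<..<pi}" "tan x + c * x = 0"
    and y: "y \<in> {pi/2<..<pi}" "tan y + c * y = 0" for x y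
  proof -
    have mono: "tan u + c * u < tan v + c * v" if "pi/2 < u" "u < v" "v < pi" for u v
      using tan_monotone[of "u - pi" "v - pi"] tan_periodic_pi[of "u - pi"]
        tan_periodic_pi[of "v - pi"] that c by (auto intro!: add_strict_mono)
    show ?thesis
      using mono[of x y] mono[of y x] x y by (cases x y rule: linorder_cases) auto
  qed
  ultimately show ?thesis using \<theta>_in by blast
qed

lemma ex1_is_alpha:
  assumes "\<epsilon> < 1" "n \<ge> 1"
  shows "\<exists>!\<alpha>. is_alpha n \<epsilon> \<alpha>"
proof -
  define L where "L = ln (real n + 1)"
  have L: "L > 0" using assms by (simp add: L_def)
  define c where "c = 2 / ((1 - \<epsilon>) * L)"
  have c: "c > 0" using L assms by (simp add: c_def)
  have eq: "is_alpha n \<epsilon> \<alpha> \<longleftrightarrow> \<alpha> * L \<in> {pi/2<..<pi} \<and> tan (\<alpha> * L) + c * (\<alpha> * L) = 0" for \<alpha>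
  proof -
    have "2 * \<alpha> / (1 - \<epsilon>) = c * (\<alpha> * L)" using L by (simp add: c_def)
    then show ?thesis using L unfolding is_alpha_def L_def[symmetric] by (auto simp: field_simps)
  qed
  obtain \<theta> where \<theta>: "\<theta> \<in> {pi/2<..<pi} \<and> tan \<theta> + c * \<theta> = 0"
    and uniq: "\<And>t. t \<in> {pi/2<..<pi} \<and> tan t + c * t = 0 \<Longrightarrow> t = \<theta>"
    using ex1_tan_plus_linear_eq_0[OF c] by blast
  show ?thesis
  proof
    show "is_alpha n \<epsilon> (\<theta> / L)" unfolding eq using \<theta> L by simp
    show "\<alpha> = \<theta> / L" if "is_alpha n \<epsilon> \<alpha>" for \<alpha>
      using uniq[of "\<alpha> * L"] that L unfolding eq by (simp add: field_simps)
  qed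
qed

section \<open>The extremal sequence\<close>

text \<open>
  The primitive of \<open>h_fun\<close> that vanishes at \<open>1\<close>. Its factor \<open>x powr s * sin (\<alpha> * ln x)\<close> is the
  imaginary part of \<open>x\<close> to the complex power \<open>s + i \<alpha>\<close>, so it solves the
  same Euler equation as \<open>x powr s\<close>, with \<open>s\<^sup>2 + \<alpha>\<^sup>2\<close> in place of \<open>s\<^sup>2\<close>.
\<close>

definition extremal_primitive :: "real \<Rightarrow> real \<Rightarrow> real \<Rightarrow> real" where
  "extremal_primitive s \<alpha> x = x powr s * sin (\<alpha> * ln x) / s"

text \<open>
  The weighted derivative \<open>x powr \<epsilon> * h_fun \<epsilon> \<alpha> x\<close> for \<open>\<epsilon> = 1 - 2 * s\<close>. The phase equation says
  that it vanishes at \<open>n + 1\<close>, the natural boundary condition at the free right end.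
\<close>

definition extremal_flux :: "real \<Rightarrow> real \<Rightarrow> real \<Rightarrow> real" where
  "extremal_flux s \<alpha> x = x powr (- s) * (\<alpha> / s * cos (\<alpha> * ln x) + sin (\<alpha> * ln x))"

lemma h_fun_half: "s \<noteq> 0 \<Longrightarrow>
  h_fun (1 - 2 * s) \<alpha> x = x powr (s - 1) * (\<alpha> / s * cos (\<alpha> * ln x) + sin (\<alpha> * ln x))"
  by (simp add: h_fun_def diff_divide_distrib add_divide_distrib)

lemma extremal_flux_eq:
  assumes "s \<noteq> 0" "x > 0"
  shows "extremal_flux s \<alpha> x = x powr (1 - 2 * s) * h_fun (1 - 2 * s) \<alpha> x"
proof -
  have "x powr (1 - 2 * s) * x powr (s - 1) = x powr (- s)"
    by (simp flip: powr_add)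
  then show ?thesis
    using assms by (simp add: h_fun_half extremal_flux_def flip: mult.assoc)
qed

lemma extremal_primitive_deriv:
  assumes "s \<noteq> 0" "x > 0"
  shows "(extremal_primitive s \<alpha> has_real_derivative h_fun (1 - 2 * s) \<alpha> x) (at x)"
proof -
  have "x powr s = x * x powr (s - 1)"
    using assms powr_add[of x 1 "s - 1"] by simp
  then show ?thesis
    unfolding extremal_primitive_def[abs_def] h_fun_half[OF assms(1)] using assms
    by (auto intro!: derivative_eq_intros simp: field_simps)
qed

text \<open>
  The Euler equation \<open>(x powr \<epsilon> F')' = - (s\<^sup>2 + \<alpha>\<^sup>2) x powr (\<epsilon> - 2) F\<close> of the continuous Hardy
  problem, for \<open>\<epsilon> = 1 - 2 s\<close>; its eigenvalue \<open>s\<^sup>2 + \<alpha>\<^sup>2\<close> is the reciprocal of the claimed constant.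
\<close>

lemma extremal_flux_deriv:
  assumes "s \<noteq> 0" "x > 0"
  shows "(extremal_flux s \<alpha> has_real_derivative
    - (s\<^sup>2 + \<alpha>\<^sup>2) * x powr (- 1 - 2 * s) * extremal_primitive s \<alpha> x) (at x)"
proof -
  have e: "x powr (- s) = x * x powr (- s - 1)"
    using assms powr_add[of x 1 "- s - 1"] by simp
  have "x powr (- 1 - 2 * s) * x powr s = x powr (- s - 1)"
    by (simp flip: powr_add)
  then have "- (s\<^sup>2 + \<alpha>\<^sup>2) * x powr (- 1 - 2 * s) * extremal_primitive s \<alpha> x
      = - (s\<^sup>2 + \<alpha>\<^sup>2) / s * (x powr (- s - 1) * sin (\<alpha> * ln x))"
    by (simp add: extremal_primitive_def flip: mult.assoc)
  moreover have "(extremal_flux s \<alpha> has_real_derivative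
      - (s\<^sup>2 + \<alpha>\<^sup>2) / s * (x powr (- s - 1) * sin (\<alpha> * ln x))) (at x)"
    unfolding extremal_flux_def[abs_def] using assms e
    by (auto intro!: derivative_eq_intros simp: field_simps power2_eq_square)
  ultimately show ?thesis by simp
qed

text \<open>
  By the Euler equation, \<open>F G\<close> has the derivative
  \<open>x powr \<epsilon> h\<^sup>2 - (s\<^sup>2 + \<alpha>\<^sup>2) x powr (\<epsilon> - 2) F\<^sup>2\<close>. Passing from the integral over \<open>[p, p + 1]\<close> to the discrete
  terms loses in the favourable direction twice: \<open>x powr \<epsilon>\<close> increases, and the mean of \<open>h\<^sup>2\<close> is at
  least the square of the mean of \<open>h\<close>; on the other side \<open>x powr (\<epsilon> - 2)\<close> decreases while \<open>F\<close>
  increases.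
\<close>

lemma extremal_step:
  fixes s \<alpha> p :: real
  assumes s: "0 < s" "s \<le> 1/2" and p: "0 < p"
    and F0: "0 \<le> extremal_primitive s \<alpha> p"
    and h0: "\<And>x. p \<le> x \<Longrightarrow> x \<le> p + 1 \<Longrightarrow> 0 \<le> h_fun (1 - 2 * s) \<alpha> x"
  defines "F \<equiv> extremal_primitive s \<alpha>" and "G \<equiv> extremal_flux s \<alpha>"
  shows "(F (p + 1) - F p)\<^sup>2 * p powr (1 - 2 * s)
      - (s\<^sup>2 + \<alpha>\<^sup>2) * (F (p + 1))\<^sup>2 * p powr (- 1 - 2 * s)
    \<le> F (p + 1) * G (p + 1) - F p * G p"
proof -
  define h where "h = h_fun (1 - 2 * s) \<alpha>"
  define a where "a = F (p + 1) - F p"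
  define \<mu> where "\<mu> = s\<^sup>2 + \<alpha>\<^sup>2"
  have F: "(F has_real_derivative h x) (at x)" if "x > 0" for x
    unfolding F_def h_def using s that by (intro extremal_primitive_deriv) auto
  have G: "(G has_real_derivative - \<mu> * x powr (- 1 - 2 * s) * F x) (at x)" if "x > 0" for x
    unfolding F_def G_def \<mu>_def using s that by (intro extremal_flux_deriv) auto
  have mono: "F x \<le> F y" if "p \<le> x" "x \<le> y" "y \<le> p + 1" for x y
    using that p h0 by (intro DERIV_nonneg_imp_nondecreasing[of x y F]) (auto intro!: exI F simp: h_def)
  \<comment> \<open>\<open>Q\<close> is \<open>F G\<close> minus a primitive of a lower bound of its derivative. There \<open>h\<^sup>2\<close> is replaced by
    its tangent \<open>2 a h - a\<^sup>2\<close> at the mean value \<open>a\<close>, whose primitive is explicit.\<close>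
  define Q where "Q x = F x * G x - p powr (1 - 2 * s) * (2 * a * F x - a\<^sup>2 * x)
    + \<mu> * p powr (- 1 - 2 * s) * (F (p + 1))\<^sup>2 * x" for x
  define Q' where "Q' x = h x * G x - \<mu> * x powr (- 1 - 2 * s) * (F x)\<^sup>2
    - p powr (1 - 2 * s) * (2 * a * h x - a\<^sup>2) + \<mu> * p powr (- 1 - 2 * s) * (F (p + 1))\<^sup>2" for x
  have Q: "(Q has_real_derivative Q' x) (at x)" if "x > 0" for x
    unfolding Q_def[abs_def] Q'_def using that
    by (auto intro!: derivative_eq_intros F G simp: power2_eq_square algebra_simps)
  have "0 \<le> Q' x" if x: "p \<le> x" "x \<le> p + 1" for x
  proof -
    have "2 * a * h x - a\<^sup>2 \<le> (h x)\<^sup>2"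
      using zero_le_power2[of "h x - a"] by (simp add: power2_diff mult_ac)
    then have "p powr (1 - 2 * s) * (2 * a * h x - a\<^sup>2) \<le> p powr (1 - 2 * s) * (h x)\<^sup>2"
      by (intro mult_left_mono) auto
    also have "\<dots> \<le> x powr (1 - 2 * s) * (h x)\<^sup>2"
      using s p x by (intro mult_right_mono powr_mono2) auto
    also have "\<dots> = h x * G x"
      using s p x by (simp add: G_def h_def extremal_flux_eq power2_eq_square)
    finally have A: "p powr (1 - 2 * s) * (2 * a * h x - a\<^sup>2) \<le> h x * G x" .
    have "x powr (- 1 - 2 * s) * (F x)\<^sup>2 \<le> p powr (- 1 - 2 * s) * (F (p + 1))\<^sup>2"
    proof (intro mult_mono)
      show "x powr (- 1 - 2 * s) \<le> p powr (- 1 - 2 * s)"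
        using s p x by (intro powr_mono2') auto
      show "(F x)\<^sup>2 \<le> (F (p + 1))\<^sup>2"
        using mono[of p x] mono[of x "p + 1"] x F0 by (intro power_mono) (auto simp: F_def)
    qed auto
    then have "\<mu> * (x powr (- 1 - 2 * s) * (F x)\<^sup>2) \<le> \<mu> * (p powr (- 1 - 2 * s) * (F (p + 1))\<^sup>2)"
      by (intro mult_left_mono) (auto simp: \<mu>_def)
    with A show ?thesis by (simp add: Q'_def mult.assoc)
  qed
  then have "Q p \<le> Q (p + 1)"
    using p by (intro DERIV_nonneg_imp_nondecreasing[of p "p + 1" Q]) (auto intro!: exI Q)
  moreover have "Q (p + 1) - Q p = F (p + 1) * G (p + 1) - F p * G p
      - p powr (1 - 2 * s) * (2 * a * (F (p + 1) - F p) - a\<^sup>2)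
      + \<mu> * p powr (- 1 - 2 * s) * (F (p + 1))\<^sup>2"
    by (simp add: Q_def algebra_simps)
  ultimately show ?thesis
    unfolding a_def[symmetric] \<mu>_def[symmetric] by (simp add: power2_eq_square algebra_simps)
qed

lemma extremal_seq_eq:
  assumes "s \<noteq> 0" "k \<ge> 1"
  shows "extremal_seq (1 - 2 * s) \<alpha> k =
    extremal_primitive s \<alpha> (real (k + 1)) - extremal_primitive s \<alpha> (real k)"
proof -
  have "(h_fun (1 - 2 * s) \<alpha> has_integral
      extremal_primitive s \<alpha> (real k + 1) - extremal_primitive s \<alpha> (real k)) {real k..real k + 1}"
  proof (rule fundamental_theorem_of_calculus)
    fix x assume "x \<in> {real k..real k + 1}"
    then have "(extremal_primitive s \<alpha> has_real_derivative h_fun (1 - 2 * s) \<alpha> x) (at x)"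
      using assms by (intro extremal_primitive_deriv) auto
    then show "(extremal_primitive s \<alpha> has_vector_derivative h_fun (1 - 2 * s) \<alpha> x)
        (at x within {real k..real k + 1})"
      unfolding has_real_derivative_iff_has_vector_derivative
      by (rule has_vector_derivative_at_within)
  qed simp
  then show ?thesis
    by (simp add: extremal_seq_def integral_unique add.commute)
qed

text \<open>
  Summing \<open>extremal_step\<close> over \<open>p = 1, \<dots>, n\<close> telescopes, and both ends vanish: \<open>F\<close> at \<open>1\<close>,
  and the flux \<open>G\<close> at \<open>n + 1\<close> by the phase equation.
\<close>

lemma extremal_sequence_bounds:
  fixes s \<alpha> :: real
  assumes s: "0 < s" "s \<le> 1/2" and n: "n \<ge> 1" and \<alpha>: "is_alpha n (1 - 2 * s) \<alpha>"
  shows "hardy_rhs n (1 - 2 * s) (extremal_seq (1 - 2 * s) \<alpha>)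
      \<le> (s\<^sup>2 + \<alpha>\<^sup>2) * hardy_lhs n (1 - 2 * s) (extremal_seq (1 - 2 * s) \<alpha>)" (is ?le)
    and "0 < hardy_rhs n (1 - 2 * s) (extremal_seq (1 - 2 * s) \<alpha>)" (is ?pos)
proof -
  define L where "L = ln (real n + 1)"
  define F where "F = extremal_primitive s \<alpha>"
  define G where "G = extremal_flux s \<alpha>"
  have L: "L > 0" using n by (simp add: L_def)
  have \<theta>: "pi / 2 < \<alpha> * L" "\<alpha> * L < pi" and tan: "tan (\<alpha> * L) = - (\<alpha> / s)"
    using \<alpha> L s unfolding is_alpha_def L_def[symmetric] by (auto simp: field_simps)
  then have \<alpha>0: "\<alpha> > 0" using L pi_gt_zero by (smt (verit) mult_nonpos_nonneg pi_half_gt_zero)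
  have cos: "cos (\<alpha> * L) < 0" using \<theta> cos_gt_zero_pi[of "pi - \<alpha> * L"] by simp
  \<comment> \<open>The phase equation turns the trigonometric factor of \<open>h\<close> into a single sine, whose sign is
    visible and which vanishes at the right end.\<close>
  have phase: "\<alpha> / s * cos t + sin t = sin (\<alpha> * L - t) / - cos (\<alpha> * L)" for t
  proof -
    have "\<alpha> / s = - sin (\<alpha> * L) / cos (\<alpha> * L)" using tan by (simp add: tan_def)
    then have "\<alpha> / s * cos t + sin t = - sin (\<alpha> * L) / cos (\<alpha> * L) * cos t + sin t" by simp
    also have "\<dots> = sin (\<alpha> * L - t) / - cos (\<alpha> * L)"
      using cos by (simp add: sin_diff field_simps)
    finally show ?thesis .
  qed
  have range: "0 \<le> \<alpha> * ln x" "\<alpha> * ln x \<le> \<alpha> * L" if "1 \<le> x" "x \<le> real n + 1" for x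
    using that \<alpha>0 by (auto simp: L_def)
  have h0: "0 \<le> h_fun (1 - 2 * s) \<alpha> x" if "1 \<le> x" "x \<le> real n + 1" for x
  proof -
    have "0 \<le> sin (\<alpha> * L - \<alpha> * ln x)"
      using range[OF that] \<theta> by (intro sin_ge_zero) auto
    then show ?thesis
      using s cos unfolding h_fun_half[OF less_imp_neq[OF s(1), symmetric]] phase
      by (intro mult_nonneg_nonneg divide_nonneg_pos) auto
  qed
  have F0: "0 \<le> F x" if "1 \<le> x" "x \<le> real n + 1" for x
  proof -
    have "0 \<le> sin (\<alpha> * ln x)" using range[OF that] \<theta> by (intro sin_ge_zero) auto
    then show ?thesis using s by (simp add: F_def extremal_primitive_def)
  qed
  have seq: "extremal_seq (1 - 2 * s) \<alpha> k = F (real k + 1) - F (real k)" if "k \<ge> 1" for k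
    using extremal_seq_eq[of s k \<alpha>] that s by (simp add: F_def add.commute)
  have F1: "F 1 = 0" by (simp add: F_def extremal_primitive_def)
  have psum: "(\<Sum>j=1..k. extremal_seq (1 - 2 * s) \<alpha> j) = F (real k + 1)" for k
  proof -
    have "(\<Sum>j=1..k. extremal_seq (1 - 2 * s) \<alpha> j) = (\<Sum>j=1..k. F (real (Suc j)) - F (real j))"
      by (intro sum.cong) (auto simp: seq add.commute)
    also have "\<dots> = F (real (Suc k)) - F (real 1)"
      by (subst sum_Suc_diff) auto
    finally show ?thesis by (simp add: F1 add.commute)
  qed
  have "hardy_rhs n (1 - 2 * s) (extremal_seq (1 - 2 * s) \<alpha>)
      - (s\<^sup>2 + \<alpha>\<^sup>2) * hardy_lhs n (1 - 2 * s) (extremal_seq (1 - 2 * s) \<alpha>)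
    = (\<Sum>k=1..n. (F (real k + 1) - F (real k))\<^sup>2 * real k powr (1 - 2 * s)
      - (s\<^sup>2 + \<alpha>\<^sup>2) * (F (real k + 1))\<^sup>2 * real k powr (- 1 - 2 * s))"
    unfolding hardy_rhs_def hardy_lhs_def psum sum_distrib_left sum_subtractf[symmetric]
  proof (intro sum.cong refl)
    fix k assume "k \<in> {1..n}"
    then have k: "k \<ge> 1" by simp
    have "real k powr (- 1 - 2 * s) = real k powr (1 - 2 * s) / (real k)\<^sup>2"
      using k powr_diff[of "real k" "1 - 2 * s" 2] by simp
    then show "(extremal_seq (1 - 2 * s) \<alpha> k)\<^sup>2 * real k powr (1 - 2 * s)
        - (s\<^sup>2 + \<alpha>\<^sup>2) * ((1 / real k * F (real k + 1))\<^sup>2 * real k powr (1 - 2 * s))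
      = (F (real k + 1) - F (real k))\<^sup>2 * real k powr (1 - 2 * s)
        - (s\<^sup>2 + \<alpha>\<^sup>2) * (F (real k + 1))\<^sup>2 * real k powr (- 1 - 2 * s)"
      using k by (simp add: seq power_divide)
  qed
  also have "\<dots> \<le> (\<Sum>k=1..n. F (real (Suc k)) * G (real (Suc k)) - F (real k) * G (real k))"
  proof (intro sum_mono)
    fix k assume "k \<in> {1..n}"
    then show "(F (real k + 1) - F (real k))\<^sup>2 * real k powr (1 - 2 * s)
        - (s\<^sup>2 + \<alpha>\<^sup>2) * (F (real k + 1))\<^sup>2 * real k powr (- 1 - 2 * s)
      \<le> F (real (Suc k)) * G (real (Suc k)) - F (real k) * G (real k)"
      using extremal_step[of s "real k" \<alpha>] s h0 F0[of "real k"]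
      by (simp add: F_def G_def add.commute)
  qed
  also have "\<dots> = F (real (Suc n)) * G (real (Suc n)) - F (real 1) * G (real 1)"
    by (subst sum_Suc_diff) auto
  also have "G (real (Suc n)) = 0"
    using phase[of "\<alpha> * L"] by (simp add: G_def extremal_flux_def L_def add.commute)
  finally show ?le by (simp add: F1)
  have "0 < F 2"
  proof -
    have "ln 2 \<le> L" using n by (simp add: L_def)
    then have "\<alpha> * ln 2 \<le> \<alpha> * L" using \<alpha>0 by simp
    then have "0 < sin (\<alpha> * ln 2)" using le_less_trans[OF _ \<theta>(2)] \<alpha>0 by (intro sin_gt_zero) auto
    then show ?thesis using s by (simp add: F_def extremal_primitive_def)
  qed
  then have "0 < (extremal_seq (1 - 2 * s) \<alpha> 1)\<^sup>2 * real 1 powr (1 - 2 * s)"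
    by (simp add: seq F1)
  also have "\<dots> \<le> hardy_rhs n (1 - 2 * s) (extremal_seq (1 - 2 * s) \<alpha>)"
    unfolding hardy_rhs_def using n by (intro member_le_sum) auto
  finally show ?pos .
qed

theorem theorem1p4:
  fixes \<epsilon> :: real and n :: nat
  assumes "0 \<le> \<epsilon>" and "\<epsilon> < 1" and "n \<ge> 1"
  shows "(\<exists>!\<alpha>. is_alpha n \<epsilon> \<alpha>) \<and>
    (\<forall>\<alpha>. is_alpha n \<epsilon> \<alpha> \<longrightarrow>
       4 / ((1 - \<epsilon>)\<^sup>2 + 4 * \<alpha>\<^sup>2) \<le> hardy_const n \<epsilon> \<and>
       hardy_const n \<epsilon> \<le> 4 / (1 - \<epsilon>)\<^sup>2
          - 4 * sqrt 2 / ((1 - \<epsilon>)\<^sup>2 * (8 + (1 - \<epsilon>)\<^sup>2)) * (1 / (ln (real n + 1))\<^sup>2) \<and>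
       hardy_lhs n \<epsilon> (extremal_seq \<epsilon> \<alpha>)
         \<ge> 4 / ((1 - \<epsilon>)\<^sup>2 + 4 * \<alpha>\<^sup>2) * hardy_rhs n \<epsilon> (extremal_seq \<epsilon> \<alpha>))"
proof (intro conjI allI impI)
  show "\<exists>!\<alpha>. is_alpha n \<epsilon> \<alpha>" using ex1_is_alpha assms by blast
  define s where "s = (1 - \<epsilon>) / 2"
  have s: "0 < s" "s \<le> 1/2" using assms by (auto simp: s_def)
  have \<epsilon>: "\<epsilon> = 1 - 2 * s" unfolding s_def by argo
  have upper: "hardy_lhs n \<epsilon> a \<le> (4 / (1 - \<epsilon>)\<^sup>2
      - 4 * sqrt 2 / ((1 - \<epsilon>)\<^sup>2 * (8 + (1 - \<epsilon>)\<^sup>2)) * (1 / (ln (real n + 1))\<^sup>2)) * hardy_rhs n \<epsilon> a" for a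
  proof -
    have "4 / (1 - \<epsilon>)\<^sup>2 - 4 * sqrt 2 / ((1 - \<epsilon>)\<^sup>2 * (8 + (1 - \<epsilon>)\<^sup>2)) * (1 / (ln (real n + 1))\<^sup>2)
      = 1 / s\<^sup>2 - sqrt 2 / (s\<^sup>2 * (8 + 4 * s\<^sup>2) * (ln (real n + 1))\<^sup>2)"
    proof -
      have b: "(1 - \<epsilon>)\<^sup>2 = 4 * s\<^sup>2" by (simp add: s_def power_divide)
      have "4 / (4 * u) - 4 * c / (4 * u * v) * (1 / w) = 1 / u - c / (u * v * w)"
        for c u v w :: real by simp
      then show ?thesis unfolding b by blast
    qed
    then show ?thesis
      using hardy_inequality_log_remainder[OF s assms(3), of a] by (simp only: \<epsilon>[symmetric])
  qed
  fix \<alpha> assume \<alpha>: "is_alpha n \<epsilon> \<alpha>"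
  let ?a = "extremal_seq \<epsilon> \<alpha>"
  have \<mu>: "4 / ((1 - \<epsilon>)\<^sup>2 + 4 * \<alpha>\<^sup>2) = 1 / (s\<^sup>2 + \<alpha>\<^sup>2)"
  proof -
    have b: "1 - \<epsilon> = 2 * s" by (simp add: s_def)
    have "(2 * s)\<^sup>2 + 4 * \<alpha>\<^sup>2 = 4 * (s\<^sup>2 + \<alpha>\<^sup>2)"
      by (simp add: power_mult_distrib)
    moreover have "4 / (4 * u) = 1 / u" for u :: real by simp
    ultimately show ?thesis unfolding b by metis
  qed
  have "0 < s\<^sup>2 + \<alpha>\<^sup>2" using s by (intro add_pos_nonneg) auto
  then show lower: "4 / ((1 - \<epsilon>)\<^sup>2 + 4 * \<alpha>\<^sup>2) * hardy_rhs n \<epsilon> ?a \<le> hardy_lhs n \<epsilon> ?a"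
    using extremal_sequence_bounds(1)[OF s assms(3), of \<alpha>] \<alpha>
    unfolding \<mu> unfolding \<epsilon> by (simp add: divide_le_eq mult.commute)
  show "hardy_const n \<epsilon> \<le> 4 / (1 - \<epsilon>)\<^sup>2
      - 4 * sqrt 2 / ((1 - \<epsilon>)\<^sup>2 * (8 + (1 - \<epsilon>)\<^sup>2)) * (1 / (ln (real n + 1))\<^sup>2)"
    by (rule hardy_const_le[OF assms(3) upper upper])
  have "4 / ((1 - \<epsilon>)\<^sup>2 + 4 * \<alpha>\<^sup>2) * hardy_rhs n \<epsilon> ?a \<le> hardy_const n \<epsilon> * hardy_rhs n \<epsilon> ?a"
    using lower hardy_const_valid[OF assms(3) upper] by (rule order_trans)
  moreover have "0 < hardy_rhs n \<epsilon> ?a"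
    using extremal_sequence_bounds(2)[OF s assms(3), of \<alpha>] \<alpha> unfolding \<epsilon> by simp
  ultimately show "4 / ((1 - \<epsilon>)\<^sup>2 + 4 * \<alpha>\<^sup>2) \<le> hardy_const n \<epsilon>"
    by (rule mult_right_le_imp_le)
qed

end
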